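(* Let $k<m$ be positive integers, $n=m-k$, let $D\in\mathbb{R}^{k\times m}$ have rank $k$, and let $v\in\mathbb{R}^k$, $v\neq 0$. Let $w\in\mathbb{R}^m$ satisfy $Dw=v$, and let $W=[w_1,\dots,w_n]\in\mathbb{R}^{m\times n}$ be a matrix whose columns form a basis of the null space of $D$. Suppose the dependent variable is given by a function $q=F(q_1,\dots,q_m)$, $F:(0,\infty)^m\to\mathbb{R}$, of the independent variables $\mathbf{q}=(q_1,\dots,q_m)^T$, and suppose that this relationship can be expressed in dimensionless form, i.e. there is a function $f:\mathbb{R}^n\to\mathbb{R}$ such that for all $\mathbf{q}\in(0,\infty)^m$, $$F(\mathbf{q})\,\exp\left(-w^T\log(\mathbf{q})\right)=f\left(\exp(w_1^T\log(\mathbf{q})),\dots,\exp(w_n^T\log(\mathbf{q}))\right).$$ Let $A=[\,w\;\; w_1\;\cdots\; w_n\,]\in\mathbb{R}^{m\times(n+1)}$. Then $A$ has full column rank $n+1$, and there is a function $h:\mathbb{R}^{n+1}\to\mathbb{R}$ such that, with $\mathbf{x}=\log(\mathbf{q})$, $$F(\mathbf{q})=h(A^T\mathbf{x})\qquad\text{for all }\mathbf{q}\in(0,\infty)^m;$$ moreover $h$ can be taken of the form $h(y_0,y_1,\dots,y_n)=\exp(y_0)\,g(y_1,\dots,y_n)$ for some function $g:\mathbb{R}^n\to\mathbb{R}$.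
   Context: The logarithm of a vector with positive entries is taken componentwise. Interpretation: there are $k$ base units; the $i$-th column of $D$ is the dimension vector (vector of exponents of the base dimensions) of the independent quantity $q_i$; $v$ is the dimension vector of the dependent quantity $q$, which is not dimensionless. The quantity $\pi=q\exp(-w^T\log(\mathbf{q}))$ is the nondimensionalized dependent variable, and $\pi_i=\exp(w_i^T\log(\mathbf{q}))$, $i=1,\dots,n$, are dimensionless groups. The Buckingham Pi Theorem states that a physical relationship can be written as $\pi=f(\pi_1,\dots,\pi_n)$; this is taken as a hypothesis in the claim. A function of $\mathbf{x}\in\mathbb{R}^m$ of the form $h(A^T\mathbf{x})$ with $A$ a full-rank matrix is called a ridge function. *)

theory Defs
  imports "HOL-Analysis.Analysis"
begin

definition pos_orthant :: "(real ^ 'm::finite) set" where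
  "pos_orthant = {q. \<forall>i. 0 < q $ i}"

definition vec_ln :: "real ^ 'm::finite \<Rightarrow> real ^ 'm" where
  "vec_ln q = (\<chi> i. ln (q $ i))"

definition null_space :: "real ^ 'm::finite ^ 'k::finite \<Rightarrow> (real ^ 'm) set" where
  "null_space D = {x. D *v x = 0}"

(* Injectivity is part of the condition because the columns are a family:
   a set of columns does not see repetitions. *)
definition columns_basis_of :: "real ^ 'n::finite ^ 'm::finite \<Rightarrow> (real ^ 'm) set \<Rightarrow> bool" where
  "columns_basis_of W S \<longleftrightarrow>
     inj (\<lambda>j. column j W) \<and> independent (columns W) \<and> span (columns W) = S"

(* The block matrix [w w_1 ... w_n].  Its n + 1 columns are indexed by 'n option:
   None is the position of the leading column (index 0), Some j that of column j of W. *)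
definition prepend_column ::
  "real ^ 'm::finite \<Rightarrow> real ^ 'n::finite ^ 'm \<Rightarrow> real ^ ('n option) ^ 'm" where
  "prepend_column w W = (\<chi> i j. case j of None \<Rightarrow> w $ i | Some l \<Rightarrow> W $ i $ l)"

end

theory Submission
  imports Defs
begin

text \<open>
  Multiplying the dimensionless relation by \<open>exp (w \<bullet> log q)\<close> expresses \<open>F q\<close> through the numbers
  \<open>w \<bullet> log q\<close> and \<open>w\<^sub>j \<bullet> log q\<close>, which are exactly the entries of \<open>A\<^sup>T x\<close>. So \<open>h\<close> is obtained by
  taking for \<open>g\<close> the function \<open>f\<close> precomposed with the componentwise exponential
  (\<open>transpose_prepend_column_mult_vec\<close> identifies the entries).

  The rank claim uses that \<open>w\<close> lies outside the null space of \<open>D\<close>, because \<open>D w = v \<noteq> 0\<close>, whereas the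
  columns of \<open>W\<close> are an independent family spanning that null space. Adjoining \<open>w\<close> therefore
  preserves independence (\<open>rank_prepend_column\<close>).
\<close>

lemma column_prepend_column:
  "column None (prepend_column w W) = w"
  "column (Some j) (prepend_column w W) = column j W"
  by (simp_all add: column_def prepend_column_def vec_eq_iff)

lemma columns_prepend_column: "columns (prepend_column w W) = insert w (columns W)"
proof -
  have "columns (prepend_column w W) = range (\<lambda>j. column j (prepend_column w W))"
    by (auto simp: columns_def)
  also have "\<dots> = insert w (range (\<lambda>j. column j W))"
    by (simp add: UNIV_option_conv image_image column_prepend_column)
  also have "range (\<lambda>j. column j W) = columns W"
    by (auto simp: columns_def)
  finally show ?thesis .
qed

lemma transpose_prepend_column_mult_vec:
  "(transpose (prepend_column w W) *v x) $ None = w \<bullet> x"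
  "(transpose (prepend_column w W) *v x) $ Some j = column j W \<bullet> x"
  by (simp_all add: matrix_vector_mult_def transpose_def prepend_column_def column_def inner_vec_def)

lemma rank_prepend_column:
  fixes w :: "real ^ 'm::finite" and W :: "real ^ 'n::finite ^ 'm"
  assumes basis: "columns_basis_of W S" and w: "w \<notin> S"
  shows "rank (prepend_column w W) = CARD('n) + 1"
proof -
  have inj: "inj (\<lambda>j. column j W)" and ind: "independent (columns W)"
    and span: "span (columns W) = S"
    using basis by (auto simp: columns_basis_of_def)
  have cols: "columns W = range (\<lambda>j. column j W)"
    by (auto simp: columns_def)
  have card: "card (columns W) = CARD('n)" and fin: "finite (columns W)"
    using inj by (simp_all add: cols card_image)
  have "w \<notin> columns W"
    using w span span_base by blast
  moreover have "independent (insert w (columns W))"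
    using ind w span by (simp add: independent_insertI)
  ultimately show ?thesis
    using card fin
    by (simp add: column_rank_def columns_prepend_column dim_eq_card_independent)
qed

theorem mainTheorem1:
  fixes D :: "real ^ 'm::finite ^ 'k::finite"
    and v :: "real ^ 'k"
    and w :: "real ^ 'm"
    and W :: "real ^ 'n::finite ^ 'm"
    and F :: "real ^ 'm \<Rightarrow> real"
  assumes "CARD('k) < CARD('m)"
    and "CARD('n) = CARD('m) - CARD('k)"
    and "rank D = CARD('k)"
    and "v \<noteq> 0"
    and "D *v w = v"
    and "columns_basis_of W (null_space D)"
    and "\<exists>f :: real ^ 'n \<Rightarrow> real. \<forall>q \<in> pos_orthant.
           F q * exp (- (w \<bullet> vec_ln q)) = f (\<chi> j. exp (column j W \<bullet> vec_ln q))"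
  shows "rank (prepend_column w W) = CARD('n) + 1 \<and>
         (\<exists>h :: real ^ ('n option) \<Rightarrow> real.
            (\<forall>q \<in> pos_orthant. F q = h (transpose (prepend_column w W) *v vec_ln q)) \<and>
            (\<exists>g :: real ^ 'n \<Rightarrow> real. \<forall>y. h y = exp (y $ None) * g (\<chi> j. y $ Some j)))"
proof
  have "w \<notin> null_space D"
    using assms(4,5) by (simp add: null_space_def)
  with assms(6) show "rank (prepend_column w W) = CARD('n) + 1"
    by (rule rank_prepend_column)
next
  obtain f :: "real ^ 'n \<Rightarrow> real" where
    f: "\<And>q. q \<in> pos_orthant \<Longrightarrow>
          F q * exp (- (w \<bullet> vec_ln q)) = f (\<chi> j. exp (column j W \<bullet> vec_ln q))"
    using assms(7) by blast
  define g where "g z = f (\<chi> j. exp (z $ j))" for z :: "real ^ 'n"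
  define h where "h y = exp (y $ None) * g (\<chi> j. y $ Some j)" for y :: "real ^ ('n option)"
  have "F q = h (transpose (prepend_column w W) *v vec_ln q)" if "q \<in> pos_orthant" for q
  proof -
    have "h (transpose (prepend_column w W) *v vec_ln q)
        = exp (w \<bullet> vec_ln q) * (F q * exp (- (w \<bullet> vec_ln q)))"
      by (simp add: h_def g_def transpose_prepend_column_mult_vec f[OF that]
          del: transpose_matrix_vector)
    also have "\<dots> = F q"
      by (simp add: exp_minus)
    finally show ?thesis by simp
  qed
  then show "\<exists>h :: real ^ ('n option) \<Rightarrow> real.
      (\<forall>q \<in> pos_orthant. F q = h (transpose (prepend_column w W) *v vec_ln q)) \<and>
      (\<exists>g :: real ^ 'n \<Rightarrow> real. \<forall>y. h y = exp (y $ None) * g (\<chi> j. y $ Some j))"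
    using h_def by blast
qed

end
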